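(* Let $(S,\cdot,{}^+,{}^\ast)$ be a DRC-restriction semigroup and $(P(S),\times_S,\star_S)$ be its strong projection algebra. Let $(P,\times,\star)$ be a strong projection algebra and $\phi:P\to P(S)$ a homomorphism of projection algebras. Let $\iota_1:P\to\mathbf S(\mathscr C(P))$, $p\mapsto[p]$, and $\iota_2:P(S)\to S$, $p\mapsto p$. Then there exists a unique $(2,1,1)$-homomorphism $\Phi:\mathbf S(\mathscr C(P))\to S$ such that $\iota_1\Phi=\phi\iota_2$ (that is, $[p]\Phi=p\phi$ for all $p\in P$), and it is given by $$[p_1,p_2,\dots,p_k]\Phi=(p_1\phi)(p_2\phi)\cdots(p_k\phi).$$
   Context: Maps are written on the right and composed from left to right. **DRC-restriction semigroups.** A DRC semigroup is a semigroup $(S,\cdot)$ with two unary operations ${}^+,{}^\ast$ such that for all $x,y\in S$: $x^+x=x$, $(xy)^+=(xy^+)^+$, $(xy)^+=x^+(xy)^+x^+$, $x^{++}=x^+$, $x^{+\ast}=x^+$; and $xx^\ast=x$, $(xy)^\ast=(x^\ast y)^\ast$, $(xy)^\ast=y^\ast(xy)^\ast y^\ast$, $x^{\ast\ast}=x^\ast$, $x^{\ast+}=x^\ast$. It is DRC-restriction if moreover $x(yx)^\ast=(yx^+)^\ast x$ and $(xy)^+x=x(x^\ast y)^+$ for all $x,y$. Its set of projections is $P(S)=\{x^+:x\in S\}=\{x^\ast:x\in S\}$, and its (strong) projection algebra is $(P(S),\times_S,\star_S)$ with $e\times_S f=(ef)^+$, $e\star_S f=(ef)^\ast$. A $(2,1,1)$-homomorphism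 preserves $\cdot$, ${}^+$ and ${}^\ast$. **Projection algebras.** A projection algebra $(P,\times,\star)$ is a nonempty set with two binary operations such that for all $e,f,g\in P$: (L1) $e\times e=e$; (L2) $(e\times f)\times e=e\times f$; (L3) $e\times(f\times g)=(e\times f)\times(f\times g)$; (L4) $(e\times f)\times g=(e\times f)\times(e\times g)$; (R1) $e\star e=e$; (R2) $f\star e=e\star(f\star e)$; (R3) $(g\star f)\star e=(g\star f)\star(f\star e)$; (R4) $g\star(f\star e)=(g\star e)\star(f\star e)$; (P3) $(e\star(f\times g))\star g=(e\star f)\star g$ and $g\times((g\star f)\times e)=g\times(f\times e)$; (P4) $(e\times f)\star e=e\times f$ and $f\times(e\star f)=e\star f$. It is strong if moreover $e\times(((e\times f)\times g)\star f)=(e\times f)\times g$ and $(f\times(g\star(f\star e)))\star e=g\star(f\star e)$ for all $e,f,g$. Homomorphisms preserve $\times$ and $\star$. Write $p\,\mathcal F_P\,q$ iff $p\times q=p$ and $p\star q=q$. **Chain semigroup.** Let $P$ be a strong projection algebra. A $P$-path is a tuple $(p_1,\dots,p_k)$, $k\geq1$, $p_i\in P$, with $p_1\,\mathcal F_P\,p_2\,\mathcal F_P\cdots\mathcal F_P\,p_k$; the set of $P$-paths is $\mathscr P(P)$, and $p\in P$ is identified with the path $(p)$. Put $\mathbf d(p_1,\dots,p_k)=p_1$, $\mathbf r(p_1,\dots,p_k)=p_k$, and $(p_1,\dots,p_k)\circ(q_1,\dots,q_l)=(p_1,\dots,p_k,q_2,\dots,q_l)$ when $p_k=q_1$. A triple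 $(e,p,f)\in P^3$ is admissible if $f=(e\star p)\star f$ and $e=e\times(p\times f)$; then $(e,e\star p,f)$ and $(e,p\times f,f)$ are $P$-paths. Let $\approx_P$ be the least equivalence relation on $\mathscr P(P)$ that relates only paths with the same $\mathbf d$ and the same $\mathbf r$, is compatible with $\circ$ on the left and on the right, and contains all pairs $((p,p),p)$ $(p\in P)$ and $((e,e\star p,f),(e,p\times f,f))$ ($(e,p,f)$ admissible). Write $[p_1,\dots,p_k]$ for the $\approx_P$-class of $(p_1,\dots,p_k)$, and $\mathscr C(P)=\mathscr P(P)/{\approx_P}$. The chain semigroup $\mathbf S(\mathscr C(P))$ is the set $\mathscr C(P)$ with the (well-defined) operations $[p_1,\dots,p_k]^+=[p_1]$, $[p_1,\dots,p_k]^\ast=[p_k]$ and $[p_1,\dots,p_k]\bullet[q_1,\dots,q_l]=[p_1',\dots,p_k',q_1',\dots,q_l']$, where $p_k'=p_k\times q_1$, $p_i'=p_i\times p_{i+1}'$ for $i=k-1,\dots,1$, $q_1'=p_k\star q_1$, and $q_j'=q_{j-1}'\star q_j$ for $j=2,\dots,l$. It is a DRC-restriction semigroup. *)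

theory Defs
  imports "HOL-Algebra.Congruence"
begin

unbundle no trancl_syntax
unbundle no rtrancl_syntax

section \<open>DRC-restriction semigroups\<close>

record 'a drc = "'a partial_object" +
  drc_mult :: "'a \<Rightarrow> 'a \<Rightarrow> 'a" (infixl \<open>\<cdot>\<index>\<close> 70)
  drc_plus :: "'a \<Rightarrow> 'a" (\<open>_\<^sup>+\<index>\<close> [1000] 999)
  drc_star :: "'a \<Rightarrow> 'a" (\<open>_\<^sup>*\<index>\<close> [1000] 999)

locale drc_semigroup =
  fixes S :: "('a, 'm) drc_scheme" (structure)
  assumes mult_closed: "x \<in> carrier S \<Longrightarrow> y \<in> carrier S \<Longrightarrow> x \<cdot> y \<in> carrier S"
    and plus_closed: "x \<in> carrier S \<Longrightarrow> x\<^sup>+ \<in> carrier S"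
    and star_closed: "x \<in> carrier S \<Longrightarrow> x\<^sup>* \<in> carrier S"
    and mult_assoc: "x \<in> carrier S \<Longrightarrow> y \<in> carrier S \<Longrightarrow> z \<in> carrier S \<Longrightarrow>
          (x \<cdot> y) \<cdot> z = x \<cdot> (y \<cdot> z)"
    and plus_mult: "x \<in> carrier S \<Longrightarrow> x\<^sup>+ \<cdot> x = x"
    and plus_congr: "x \<in> carrier S \<Longrightarrow> y \<in> carrier S \<Longrightarrow> (x \<cdot> y)\<^sup>+ = (x \<cdot> y\<^sup>+)\<^sup>+"
    and plus_le: "x \<in> carrier S \<Longrightarrow> y \<in> carrier S \<Longrightarrow> (x \<cdot> y)\<^sup>+ = x\<^sup>+ \<cdot> (x \<cdot> y)\<^sup>+ \<cdot> x\<^sup>+"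
    and plus_plus: "x \<in> carrier S \<Longrightarrow> (x\<^sup>+)\<^sup>+ = x\<^sup>+"
    and plus_star: "x \<in> carrier S \<Longrightarrow> (x\<^sup>+)\<^sup>* = x\<^sup>+"
    and mult_star: "x \<in> carrier S \<Longrightarrow> x \<cdot> x\<^sup>* = x"
    and star_congr: "x \<in> carrier S \<Longrightarrow> y \<in> carrier S \<Longrightarrow> (x \<cdot> y)\<^sup>* = (x\<^sup>* \<cdot> y)\<^sup>*"
    and star_le: "x \<in> carrier S \<Longrightarrow> y \<in> carrier S \<Longrightarrow> (x \<cdot> y)\<^sup>* = y\<^sup>* \<cdot> (x \<cdot> y)\<^sup>* \<cdot> y\<^sup>*"
    and star_star: "x \<in> carrier S \<Longrightarrow> (x\<^sup>*)\<^sup>* = x\<^sup>*"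
    and star_plus: "x \<in> carrier S \<Longrightarrow> (x\<^sup>*)\<^sup>+ = x\<^sup>*"

locale drc_restriction_semigroup = drc_semigroup +
  assumes star_move: "x \<in> carrier S \<Longrightarrow> y \<in> carrier S \<Longrightarrow> x \<cdot> (y \<cdot> x)\<^sup>* = (y \<cdot> x\<^sup>+)\<^sup>* \<cdot> x"
    and plus_move: "x \<in> carrier S \<Longrightarrow> y \<in> carrier S \<Longrightarrow> (x \<cdot> y)\<^sup>+ \<cdot> x = x \<cdot> (x\<^sup>* \<cdot> y)\<^sup>+"

definition drc_hom :: "('a, 'm) drc_scheme \<Rightarrow> ('b, 'n) drc_scheme \<Rightarrow> ('a \<Rightarrow> 'b) set" where
  "drc_hom S T = {h \<in> carrier S \<rightarrow> carrier T.
     (\<forall>x\<in>carrier S. \<forall>y\<in>carrier S. h (x \<cdot>\<^bsub>S\<^esub> y) = h x \<cdot>\<^bsub>T\<^esub> h y) \<and>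
     (\<forall>x\<in>carrier S. h (x\<^sup>+\<^bsub>S\<^esub>) = (h x)\<^sup>+\<^bsub>T\<^esub>) \<and>
     (\<forall>x\<in>carrier S. h (x\<^sup>*\<^bsub>S\<^esub>) = (h x)\<^sup>*\<^bsub>T\<^esub>)}"

text \<open>The product of a nonempty list; the value on the empty list is irrelevant.\<close>

definition drc_prod :: "('a, 'm) drc_scheme \<Rightarrow> 'a list \<Rightarrow> 'a" where
  "drc_prod S xs = foldl (drc_mult S) (hd xs) (tl xs)"

section \<open>Projection algebras\<close>

record 'a proj_alg = "'a partial_object" +
  pa_times :: "'a \<Rightarrow> 'a \<Rightarrow> 'a" (infixl \<open>\<^bold>\<times>\<index>\<close> 70)
  pa_star :: "'a \<Rightarrow> 'a \<Rightarrow> 'a" (infixl \<open>\<star>\<index>\<close> 70)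

locale projection_algebra =
  fixes P :: "('a, 'm) proj_alg_scheme" (structure)
  assumes nonempty: "carrier P \<noteq> {}"
    and times_closed: "e \<in> carrier P \<Longrightarrow> f \<in> carrier P \<Longrightarrow> e \<^bold>\<times> f \<in> carrier P"
    and star_closed: "e \<in> carrier P \<Longrightarrow> f \<in> carrier P \<Longrightarrow> e \<star> f \<in> carrier P"
    and L1: "e \<in> carrier P \<Longrightarrow> e \<^bold>\<times> e = e"
    and L2: "e \<in> carrier P \<Longrightarrow> f \<in> carrier P \<Longrightarrow> (e \<^bold>\<times> f) \<^bold>\<times> e = e \<^bold>\<times> f"
    and L3: "e \<in> carrier P \<Longrightarrow> f \<in> carrier P \<Longrightarrow> g \<in> carrier P \<Longrightarrow>
          e \<^bold>\<times> (f \<^bold>\<times> g) = (e \<^bold>\<times> f) \<^bold>\<times> (f \<^bold>\<times> g)"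
    and L4: "e \<in> carrier P \<Longrightarrow> f \<in> carrier P \<Longrightarrow> g \<in> carrier P \<Longrightarrow>
          (e \<^bold>\<times> f) \<^bold>\<times> g = (e \<^bold>\<times> f) \<^bold>\<times> (e \<^bold>\<times> g)"
    and R1: "e \<in> carrier P \<Longrightarrow> e \<star> e = e"
    and R2: "e \<in> carrier P \<Longrightarrow> f \<in> carrier P \<Longrightarrow> f \<star> e = e \<star> (f \<star> e)"
    and R3: "e \<in> carrier P \<Longrightarrow> f \<in> carrier P \<Longrightarrow> g \<in> carrier P \<Longrightarrow>
          (g \<star> f) \<star> e = (g \<star> f) \<star> (f \<star> e)"
    and R4: "e \<in> carrier P \<Longrightarrow> f \<in> carrier P \<Longrightarrow> g \<in> carrier P \<Longrightarrow>
          g \<star> (f \<star> e) = (g \<star> e) \<star> (f \<star> e)"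
    and P3_star: "e \<in> carrier P \<Longrightarrow> f \<in> carrier P \<Longrightarrow> g \<in> carrier P \<Longrightarrow>
          (e \<star> (f \<^bold>\<times> g)) \<star> g = (e \<star> f) \<star> g"
    and P3_times: "e \<in> carrier P \<Longrightarrow> f \<in> carrier P \<Longrightarrow> g \<in> carrier P \<Longrightarrow>
          g \<^bold>\<times> ((g \<star> f) \<^bold>\<times> e) = g \<^bold>\<times> (f \<^bold>\<times> e)"
    and P4_star: "e \<in> carrier P \<Longrightarrow> f \<in> carrier P \<Longrightarrow> (e \<^bold>\<times> f) \<star> e = e \<^bold>\<times> f"
    and P4_times: "e \<in> carrier P \<Longrightarrow> f \<in> carrier P \<Longrightarrow> f \<^bold>\<times> (e \<star> f) = e \<star> f"

locale strong_projection_algebra = projection_algebra +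
  assumes strong_times: "e \<in> carrier P \<Longrightarrow> f \<in> carrier P \<Longrightarrow> g \<in> carrier P \<Longrightarrow>
          e \<^bold>\<times> (((e \<^bold>\<times> f) \<^bold>\<times> g) \<star> f) = (e \<^bold>\<times> f) \<^bold>\<times> g"
    and strong_star: "e \<in> carrier P \<Longrightarrow> f \<in> carrier P \<Longrightarrow> g \<in> carrier P \<Longrightarrow>
          (f \<^bold>\<times> (g \<star> (f \<star> e))) \<star> e = g \<star> (f \<star> e)"

definition proj_hom :: "('a, 'm) proj_alg_scheme \<Rightarrow> ('b, 'n) proj_alg_scheme \<Rightarrow> ('a \<Rightarrow> 'b) set" where
  "proj_hom P Q = {h \<in> carrier P \<rightarrow> carrier Q.
     \<forall>e\<in>carrier P. \<forall>f\<in>carrier P.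
       h (e \<^bold>\<times>\<^bsub>P\<^esub> f) = h e \<^bold>\<times>\<^bsub>Q\<^esub> h f \<and> h (e \<star>\<^bsub>P\<^esub> f) = h e \<star>\<^bsub>Q\<^esub> h f}"

definition projections :: "('a, 'm) drc_scheme \<Rightarrow> 'a proj_alg" where
  "projections S =
     \<lparr> carrier = {x\<^sup>+\<^bsub>S\<^esub> | x. x \<in> carrier S},
       pa_times = (\<lambda>e f. (e \<cdot>\<^bsub>S\<^esub> f)\<^sup>+\<^bsub>S\<^esub>),
       pa_star = (\<lambda>e f. (e \<cdot>\<^bsub>S\<^esub> f)\<^sup>*\<^bsub>S\<^esub>) \<rparr>"

definition proj_rel :: "('a, 'm) proj_alg_scheme \<Rightarrow> 'a \<Rightarrow> 'a \<Rightarrow> bool" (\<open>\<F>\<index>\<close>) where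
  "\<F>\<^bsub>P\<^esub> p q \<longleftrightarrow> p \<^bold>\<times>\<^bsub>P\<^esub> q = p \<and> p \<star>\<^bsub>P\<^esub> q = q"

section \<open>The chain semigroup\<close>

text \<open>A path is a nonempty list; its end points are \<^term>\<open>hd ps\<close> and \<^term>\<open>last ps\<close>.\<close>

definition paths :: "('a, 'm) proj_alg_scheme \<Rightarrow> 'a list set" where
  "paths P = {ps. ps \<noteq> [] \<and> set ps \<subseteq> carrier P \<and> successively (\<F>\<^bsub>P\<^esub>) ps}"

text \<open>Composition of paths, meaningful only if \<^term>\<open>last ps = hd qs\<close>.\<close>

definition path_comp :: "'a list \<Rightarrow> 'a list \<Rightarrow> 'a list" where
  "path_comp ps qs = ps @ tl qs"

definition admissible :: "('a, 'm) proj_alg_scheme \<Rightarrow> 'a \<Rightarrow> 'a \<Rightarrow> 'a \<Rightarrow> bool" where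
  "admissible P e p f \<longleftrightarrow> {e, p, f} \<subseteq> carrier P \<and>
     f = (e \<star>\<^bsub>P\<^esub> p) \<star>\<^bsub>P\<^esub> f \<and> e = e \<^bold>\<times>\<^bsub>P\<^esub> (p \<^bold>\<times>\<^bsub>P\<^esub> f)"

definition path_congruence :: "('a, 'm) proj_alg_scheme \<Rightarrow> ('a list \<times> 'a list) set \<Rightarrow> bool" where
  "path_congruence P R \<longleftrightarrow>
     equiv (paths P) R \<and>
     (\<forall>(ps, qs)\<in>R. hd ps = hd qs \<and> last ps = last qs) \<and>
     (\<forall>(ps, qs)\<in>R. \<forall>us\<in>paths P. last us = hd ps \<longrightarrow> (path_comp us ps, path_comp us qs) \<in> R) \<and>
     (\<forall>(ps, qs)\<in>R. \<forall>us\<in>paths P. last ps = hd us \<longrightarrow> (path_comp ps us, path_comp qs us) \<in> R)"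

definition chain_generators :: "('a, 'm) proj_alg_scheme \<Rightarrow> ('a list \<times> 'a list) set" where
  "chain_generators P =
     {([p, p], [p]) | p. p \<in> carrier P} \<union>
     {([e, e \<star>\<^bsub>P\<^esub> p, f], [e, p \<^bold>\<times>\<^bsub>P\<^esub> f, f]) | e p f. admissible P e p f}"

definition chain_rel :: "('a, 'm) proj_alg_scheme \<Rightarrow> ('a list \<times> 'a list) set" where
  "chain_rel P = \<Inter>{R. path_congruence P R \<and> chain_generators P \<subseteq> R}"

definition chain_class :: "('a, 'm) proj_alg_scheme \<Rightarrow> 'a list \<Rightarrow> 'a list set" where
  "chain_class P ps = chain_rel P `` {ps}"

text \<open>
  With \<open>ps = [p\<^sub>1, \<dots>, p\<^sub>k]\<close>, the list \<open>push_left P ps q\<close> is \<open>[p\<^sub>1', \<dots>, p\<^sub>k']\<close> where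
  \<open>p\<^sub>k' = p\<^sub>k \<times> q\<close> and \<open>p\<^sub>i' = p\<^sub>i \<times> p\<^sub>i\<^sub>+\<^sub>1'\<close>; with \<open>qs = [q\<^sub>1, \<dots>, q\<^sub>l]\<close>, the list
  \<open>push_right P p qs\<close> is \<open>[q\<^sub>1', \<dots>, q\<^sub>l']\<close> where \<open>q\<^sub>1' = p \<star> q\<^sub>1\<close> and
  \<open>q\<^sub>j' = q\<^sub>j\<^sub>-\<^sub>1' \<star> q\<^sub>j\<close>.
\<close>

primrec push_left :: "('a, 'm) proj_alg_scheme \<Rightarrow> 'a list \<Rightarrow> 'a \<Rightarrow> 'a list" where
  "push_left P [] q = []"
| "push_left P (p # ps) q = (p \<^bold>\<times>\<^bsub>P\<^esub> hd (push_left P ps q @ [q])) # push_left P ps q"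

primrec push_right :: "('a, 'm) proj_alg_scheme \<Rightarrow> 'a \<Rightarrow> 'a list \<Rightarrow> 'a list" where
  "push_right P p [] = []"
| "push_right P p (q # qs) = (p \<star>\<^bsub>P\<^esub> q) # push_right P (p \<star>\<^bsub>P\<^esub> q) qs"

definition path_prod :: "('a, 'm) proj_alg_scheme \<Rightarrow> 'a list \<Rightarrow> 'a list \<Rightarrow> 'a list" where
  "path_prod P ps qs = push_left P ps (hd qs) @ push_right P (last ps) qs"

text \<open>
  The operations on classes are defined through all representatives, as usual for quotients:
  whenever the class of the result does not depend on the representatives, the union is that class.
\<close>

definition chain_semigroup :: "('a, 'm) proj_alg_scheme \<Rightarrow> 'a list set drc" where
  "chain_semigroup P =
     \<lparr> carrier = paths P // chain_rel P,
       drc_mult = (\<lambda>X Y. \<Union>ps\<in>X. \<Union>qs\<in>Y. chain_class P (path_prod P ps qs)),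
       drc_plus = (\<lambda>X. \<Union>ps\<in>X. chain_class P [hd ps]),
       drc_star = (\<lambda>X. \<Union>ps\<in>X. chain_class P [last ps]) \<rparr>"

end

theory Submission
  imports Defs
begin

text \<open>
  The chain semigroup is generated by the classes \<open>[p]\<close>. If \<open>p \<F> p\<^sub>1\<close>, then multiplying \<open>[p]\<close> with
  \<open>[p\<^sub>1, \<dots>, p\<^sub>k]\<close> changes no entry of either path, so \<open>[p, p\<^sub>1, \<dots>, p\<^sub>k] = [p] \<bullet> [p\<^sub>1, \<dots>, p\<^sub>k]\<close>, and a
  homomorphism that extends \<open>\<phi>\<close> must send \<open>[p\<^sub>1, \<dots>, p\<^sub>k]\<close> to \<open>(p\<^sub>1 \<phi>) \<cdots> (p\<^sub>k \<phi>)\<close>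
  (\<open>hom_chain_class\<close>). This gives uniqueness and the formula. For existence, three things have to
  be shown of this formula.

  \<^item> The operations of the chain semigroup do not depend on representatives, so that they can be
    computed on paths (\<open>chain_class_mult\<close>). The content is that pushing congruent paths
    through a projection yields congruent paths. Pushing is compatible with composition of paths, so
    it suffices to treat the generators of the congruence. By the strong axioms,
    \<open>(e \<times> (p \<times> f)) \<star> p = (e \<star> p) \<times> f\<close> and \<open>p \<times> ((e \<star> p) \<star> f) = e \<star> (p \<times> f)\<close>, and these two
    identities make each generator \<open>([e, e \<star> p, f], [e, p \<times> f, f])\<close> go to a generator of the same
    form with the same middle element \<open>p\<close>.

  \<^item> The formula is constant on congruence classes (\<open>value_of_chain_rel\<close>). In \<open>S\<close>, projections
    satisfy \<open>e (e p)\<^sup>* = e p\<close> and \<open>(p f)\<^sup>+ f = p f\<close>; hence both sides of a generator have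
    the product \<open>e p f\<close>.

  \<^item> It respects the operations (\<open>induced_hom\<close>). For \<open>\<cdot>\<close>, a product of projections
    multiplied by \<open>f\<close> is unchanged when the list is pushed through \<open>f\<close>, and dually; at the junction,
    \<open>(e f)\<^sup>+ (e f)\<^sup>* = e f\<close>. For the unary operations, \<open>e \<F> f\<close> says exactly that
    \<open>(e f)\<^sup>+ = e\<close> and \<open>(e f)\<^sup>* = f\<close>, so the product of a path has its end points as
    \<open>\<^sup>+\<close> and \<open>\<^sup>*\<close>.

  Both the axioms and the construction are left-right symmetric, so most facts come in dual pairs
  that hold for dual reasons.
\<close>

section \<open>Pushing a list through an element\<close>

lemma push_left_Nil_iff [simp]: "push_left Q es f = [] \<longleftrightarrow> es = []"
  by (cases es) auto

lemma push_right_Nil_iff [simp]: "push_right Q e fs = [] \<longleftrightarrow> fs = []"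
  by (cases fs) auto

lemma hd_push_right: "fs \<noteq> [] \<Longrightarrow> hd (push_right Q e fs) = e \<star>\<^bsub>Q\<^esub> hd fs"
  by (cases fs) auto

lemma last_push_left: "es \<noteq> [] \<Longrightarrow> last (push_left Q es f) = last es \<^bold>\<times>\<^bsub>Q\<^esub> f"
  by (induction es) auto

lemma push_left_append:
  "push_left Q (es @ fs) r = push_left Q es (hd (push_left Q fs r @ [r])) @ push_left Q fs r"
  by (induction es) (auto simp: hd_append)

lemma push_right_append:
  "push_right Q r (es @ fs) = push_right Q r es @ push_right Q (last (r # push_right Q r es)) fs"
  by (induction es arbitrary: r) auto

section \<open>Identities in projection algebras\<close>

context projection_algebra
begin

lemma times_absorb:
  assumes "e \<in> carrier P" "f \<in> carrier P"
  shows "e \<^bold>\<times> (e \<^bold>\<times> f) = e \<^bold>\<times> f"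
  using L4[of e e f] L1[of e] assms by simp

lemma star_absorb:
  assumes "e \<in> carrier P" "f \<in> carrier P"
  shows "(e \<star> f) \<star> f = e \<star> f"
  using R4[of f f e] R1[of f] assms by simp

lemma times_times_same:
  assumes "e \<in> carrier P" "f \<in> carrier P"
  shows "(e \<^bold>\<times> f) \<^bold>\<times> f = e \<^bold>\<times> f"
  using L4[of e f f] L1[of "e \<^bold>\<times> f"] assms by (simp add: times_closed)

lemma star_star_same:
  assumes "e \<in> carrier P" "f \<in> carrier P"
  shows "e \<star> (e \<star> f) = e \<star> f"
  using R4[of f e e] R1[of "e \<star> f"] assms by (simp add: star_closed)

lemma star_eq_times:
  assumes "e \<in> carrier P" "f \<in> carrier P"
  shows "e \<star> (e \<^bold>\<times> f) = e \<^bold>\<times> f"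
  using R2[of e "e \<^bold>\<times> f"] P4_star[of e f] assms by (simp add: times_closed)

lemma times_eq_star:
  assumes "e \<in> carrier P" "f \<in> carrier P"
  shows "(e \<star> f) \<^bold>\<times> f = e \<star> f"
  using L2[of f "e \<star> f"] P4_times[of e f] assms by (simp add: star_closed)

lemma times_star_eq_star:
  assumes "e \<in> carrier P" "f \<in> carrier P"
  shows "(e \<^bold>\<times> f) \<star> f = e \<star> f"
  using P3_star[of e e f] star_eq_times[of e f] R1[of e] assms by simp

lemma times_star_eq_times:
  assumes "e \<in> carrier P" "f \<in> carrier P"
  shows "e \<^bold>\<times> (e \<star> f) = e \<^bold>\<times> f"
  using P3_times[of f f e] times_eq_star[of e f] L1[of f] assms by simp

lemma proj_rel_times_star:
  assumes "e \<in> carrier P" "f \<in> carrier P"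
  shows "\<F> (e \<^bold>\<times> f) (e \<star> f)"
proof -
  have "(e \<^bold>\<times> f) \<star> (e \<star> f) = e \<star> f"
    using R3[of f e "e \<^bold>\<times> f"] assms by (simp add: P4_star times_closed times_star_eq_star)
  moreover have "(e \<^bold>\<times> f) \<^bold>\<times> (e \<star> f) = e \<^bold>\<times> f"
    using L3[of e f "e \<star> f"] assms by (simp add: P4_times star_closed times_star_eq_times)
  ultimately show ?thesis by (simp add: proj_rel_def)
qed

lemma proj_rel_star_times:
  assumes "p \<in> carrier P" "q \<in> carrier P" "r \<in> carrier P" "\<F> p q"
  shows "p \<star> (q \<^bold>\<times> r) = q \<^bold>\<times> r"
  using R4[of q "q \<^bold>\<times> r" p] assms
  by (simp add: proj_rel_def P4_star star_eq_times times_closed)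

lemma proj_rel_times_star_right:
  assumes "p \<in> carrier P" "q \<in> carrier P" "r \<in> carrier P" "\<F> p q"
  shows "(r \<star> p) \<^bold>\<times> q = r \<star> p"
  using L4[of p "r \<star> p" q] assms
  by (simp add: proj_rel_def P4_times times_eq_star star_closed)

text \<open>
  The step of the induction that shows pushed paths to be paths: two neighbours stay related.
\<close>

lemma proj_rel_push_left:
  assumes "p \<in> carrier P" "q \<in> carrier P" "r \<in> carrier P" "\<F> p q"
  shows "\<F> (p \<^bold>\<times> (q \<^bold>\<times> r)) (q \<^bold>\<times> r)"
  using assms proj_rel_star_times[OF assms]
  by (simp add: proj_rel_def times_closed times_times_same times_star_eq_star)

lemma proj_rel_push_right:
  assumes "p \<in> carrier P" "q \<in> carrier P" "r \<in> carrier P" "\<F> p q"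
  shows "\<F> (r \<star> p) ((r \<star> p) \<star> q)"
  using assms proj_rel_times_star_right[OF assms]
  by (simp add: proj_rel_def star_closed star_star_same times_star_eq_times)

section \<open>Paths\<close>

lemma singleton_path: "p \<in> carrier P \<Longrightarrow> [p] \<in> paths P"
  by (simp add: paths_def)

lemma not_Nil_path: "ps \<in> paths P \<Longrightarrow> ps \<noteq> []"
  by (simp add: paths_def)

lemma hd_path: "ps \<in> paths P \<Longrightarrow> hd ps \<in> carrier P"
  and last_path: "ps \<in> paths P \<Longrightarrow> last ps \<in> carrier P"
  by (auto simp: paths_def)

lemma hd_path_comp: "ps \<noteq> [] \<Longrightarrow> hd (path_comp ps qs) = hd ps"
  by (simp add: path_comp_def)

lemma last_path_comp:
  "qs \<noteq> [] \<Longrightarrow> last ps = hd qs \<Longrightarrow> last (path_comp ps qs) = last qs"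
  by (cases qs) (auto simp: path_comp_def)

lemma append_path:
  assumes "ps \<in> paths P" "qs \<in> paths P" "\<F> (last ps) (hd qs)"
  shows "ps @ qs \<in> paths P"
  using assms by (auto simp: paths_def successively_append_iff)

lemma path_comp_path:
  assumes "ps \<in> paths P" "qs \<in> paths P" "last ps = hd qs"
  shows "path_comp ps qs \<in> paths P"
proof -
  obtain q qs' where qs: "qs = q # qs'"
    using assms(2) by (cases qs) (auto simp: paths_def)
  then show ?thesis
    using assms by (cases qs') (auto simp: path_comp_def paths_def successively_append_iff)
qed

lemma hd_push_left_closed:
  "set ps \<subseteq> carrier P \<Longrightarrow> q \<in> carrier P \<Longrightarrow> hd (push_left P ps q @ [q]) \<in> carrier P"
  by (induction ps) (auto simp: times_closed)

lemma last_push_right_closed: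
  "set qs \<subseteq> carrier P \<Longrightarrow> p \<in> carrier P \<Longrightarrow> last (p # push_right P p qs) \<in> carrier P"
  by (induction qs arbitrary: p) (auto simp: star_closed)

lemma push_left_path:
  "ps \<in> paths P \<Longrightarrow> q \<in> carrier P \<Longrightarrow> push_left P ps q \<in> paths P"
proof (induction ps)
  case Nil
  then show ?case by (simp add: paths_def)
next
  case (Cons p ps)
  show ?case
  proof (cases ps)
    case Nil
    then show ?thesis using Cons.prems by (simp add: paths_def times_closed)
  next
    case C: (Cons p' ps')
    have IH: "push_left P ps q \<in> paths P" and F: "\<F> p p'"
      and p: "p \<in> carrier P" "p' \<in> carrier P" "set ps' \<subseteq> carrier P"
      using Cons C by (auto simp: paths_def)
    define r where "r = hd (push_left P ps' q @ [q])"
    have r: "r \<in> carrier P" using hd_push_left_closed p Cons.prems by (simp add: r_def)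
    have hd: "hd (push_left P ps q) = p' \<^bold>\<times> r" using C by (simp add: r_def)
    have "[p \<^bold>\<times> (p' \<^bold>\<times> r)] @ push_left P ps q \<in> paths P"
      using p r IH proj_rel_push_left[OF p(1,2) r F] hd
      by (intro append_path singleton_path) (auto simp: times_closed)
    then show ?thesis using C hd by simp
  qed
qed

lemma push_right_path:
  "qs \<in> paths P \<Longrightarrow> p \<in> carrier P \<Longrightarrow> push_right P p qs \<in> paths P"
proof (induction qs arbitrary: p)
  case Nil
  then show ?case by (simp add: paths_def)
next
  case (Cons q qs)
  have q: "q \<in> carrier P" using Cons.prems by (simp add: paths_def)
  show ?case
  proof (cases qs)
    case Nil
    then show ?thesis using Cons.prems q by (simp add: paths_def star_closed)
  next
    case C: (Cons q' qs')
    have qs: "qs \<in> paths P" and F: "\<F> q q'" and q': "q' \<in> carrier P"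
      using Cons.prems C by (auto simp: paths_def)
    have pq: "p \<star> q \<in> carrier P" using q Cons.prems by (simp add: star_closed)
    have "[p \<star> q] @ push_right P (p \<star> q) qs \<in> paths P"
      using Cons.IH[OF qs pq] pq proj_rel_push_right[OF q q' Cons.prems(2) F] C
      by (intro append_path singleton_path) auto
    then show ?thesis by simp
  qed
qed

lemma path_prod_path:
  assumes "ps \<in> paths P" "qs \<in> paths P"
  shows "path_prod P ps qs \<in> paths P"
  unfolding path_prod_def
proof (rule append_path)
  show "\<F> (last (push_left P ps (hd qs))) (hd (push_right P (last ps) qs))"
    using assms proj_rel_times_star[OF last_path hd_path, OF assms]
    by (auto simp: last_push_left hd_push_right paths_def)
qed (use assms in \<open>simp_all add: push_left_path push_right_path hd_path last_path\<close>)

text \<open>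
  The head of \<open>push_left P ps q\<close> has the form \<open>hd ps \<times> r\<close>. This makes the pushed paths in
  \<open>push_left_path_comp\<close> meet: the left factor, pushed through this head, again ends in it.
\<close>

lemma hd_push_left_absorb:
  assumes "ps \<in> paths P" "q \<in> carrier P"
  shows "hd ps \<^bold>\<times> hd (push_left P ps q) = hd (push_left P ps q)"
proof -
  obtain p ps' where ps: "ps = p # ps'" "p \<in> carrier P" "set ps' \<subseteq> carrier P"
    using assms by (cases ps) (auto simp: paths_def)
  then show ?thesis using hd_push_left_closed assms by (simp add: times_absorb)
qed

lemma last_push_right_absorb:
  assumes "qs \<in> paths P" "p \<in> carrier P"
  shows "last (push_right P p qs) \<star> last qs = last (push_right P p qs)"
proof -
  obtain q qs' where qs: "qs = qs' @ [q]" "q \<in> carrier P" "set qs' \<subseteq> carrier P"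
    using assms by (cases qs rule: rev_cases) (auto simp: paths_def)
  then show ?thesis
    using last_push_right_closed[OF qs(3) assms(2)] by (simp add: push_right_append star_absorb)
qed

lemma push_left_path_comp:
  assumes "us \<in> paths P" "ps \<in> paths P" "last us = hd ps" "q \<in> carrier P"
  shows "push_left P (path_comp us ps) q
           = path_comp (push_left P us (hd (push_left P ps q))) (push_left P ps q)"
proof -
  obtain x us' where us: "us = us' @ [x]"
    using assms(1) by (cases us rule: rev_cases) (auto simp: paths_def)
  obtain ps' where ps: "ps = x # ps'"
    using assms us by (cases ps) (auto simp: paths_def)
  have "x \<^bold>\<times> hd (push_left P ps q) = hd (push_left P ps q)"
    using hd_push_left_absorb[OF assms(2,4)] ps by simp
  then show ?thesis
    by (simp add: us ps path_comp_def push_left_append)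
qed

lemma push_right_path_comp:
  assumes "ps \<in> paths P" "us \<in> paths P" "last ps = hd us" "q \<in> carrier P"
  shows "push_right P q (path_comp ps us)
           = path_comp (push_right P q ps) (push_right P (last (push_right P q ps)) us)"
proof -
  obtain x ps' where ps: "ps = ps' @ [x]"
    using assms(1) by (cases ps rule: rev_cases) (auto simp: paths_def)
  obtain us' where us: "us = x # us'"
    using assms ps by (cases us) (auto simp: paths_def)
  have "last (push_right P q ps) \<star> x = last (push_right P q ps)"
    using last_push_right_absorb[OF assms(1,4)] ps by simp
  then show ?thesis
    by (simp add: us ps path_comp_def push_right_append)
qed

lemma push_right_self:
  "successively (\<F>) (p # ps) \<Longrightarrow> push_right P p ps = ps"
  by (induction ps arbitrary: p) (auto simp: proj_rel_def)

text \<open>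
  Paths are products of their entries already at the level of lists, before passing to classes.
\<close>

lemma path_prod_Cons:
  assumes "p # ps \<in> paths P" "ps \<noteq> []"
  shows "path_prod P [p] ps = p # ps"
proof -
  have "successively (\<F>) (p # ps)" using assms(1) by (simp add: paths_def)
  moreover from this have "p \<^bold>\<times> hd ps = p"
    using assms(2) by (cases ps) (auto simp: proj_rel_def)
  ultimately show ?thesis by (simp add: path_prod_def push_right_self)
qed

end

section \<open>The chain congruence\<close>

context strong_projection_algebra
begin

text \<open>
  The use made of the strong axiom: with \<open>g = (e \<star> p) \<times> f\<close> one has \<open>g \<star> (e \<star> p) = g\<close> by (P4), so
  the axiom gives \<open>(e \<times> g) \<star> p = g\<close>, while \<open>e \<times> g = e \<times> (p \<times> f)\<close> by (P3).
\<close>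

lemma times_star_interchange:
  assumes "e \<in> carrier P" "p \<in> carrier P" "f \<in> carrier P"
  shows "(e \<^bold>\<times> (p \<^bold>\<times> f)) \<star> p = (e \<star> p) \<^bold>\<times> f"
proof -
  let ?g = "(e \<star> p) \<^bold>\<times> f"
  have g: "?g \<star> (e \<star> p) = ?g" "?g \<in> carrier P"
    using assms by (simp_all add: P4_star star_closed times_closed)
  have "(e \<^bold>\<times> ?g) \<star> p = ?g"
    using strong_star[of p e ?g] g assms by simp
  then show ?thesis using P3_times[of f p e] assms by simp
qed

lemma star_times_interchange:
  assumes "e \<in> carrier P" "p \<in> carrier P" "f \<in> carrier P"
  shows "p \<^bold>\<times> ((e \<star> p) \<star> f) = e \<star> (p \<^bold>\<times> f)"
proof -
  let ?g = "e \<star> (p \<^bold>\<times> f)"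
  have g: "(p \<^bold>\<times> f) \<^bold>\<times> ?g = ?g" "?g \<in> carrier P"
    using assms by (simp_all add: P4_times star_closed times_closed)
  have "p \<^bold>\<times> (?g \<star> f) = ?g"
    using strong_times[of p f ?g] g assms by simp
  then show ?thesis using P3_star[of e p f] assms by simp
qed

text \<open>
  For an admissible triple the interchange identities give \<open>(e \<star> p) \<times> f = e \<star> p\<close> and
  \<open>e \<star> (p \<times> f) = p \<times> f\<close>, which are the less obvious halves of the required relations.
\<close>

lemma admissible_paths:
  assumes "admissible P e p f"
  shows "[e, e \<star> p, f] \<in> paths P" "[e, p \<^bold>\<times> f, f] \<in> paths P"
proof -
  have c: "e \<in> carrier P" "p \<in> carrier P" "f \<in> carrier P"
    and f: "(e \<star> p) \<star> f = f" and e: "e \<^bold>\<times> (p \<^bold>\<times> f) = e"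
    using assms by (auto simp: admissible_def)
  have s: "(e \<star> p) \<^bold>\<times> f = e \<star> p" and t: "e \<star> (p \<^bold>\<times> f) = p \<^bold>\<times> f"
    using times_star_interchange[OF c] star_times_interchange[OF c] e f by auto
  have "e \<^bold>\<times> (e \<star> p) = e"
    using P3_times[of f p e] c s e by simp
  moreover have "(p \<^bold>\<times> f) \<star> f = f"
    using P3_star[of e p f] c t f by simp
  ultimately show "[e, e \<star> p, f] \<in> paths P" "[e, p \<^bold>\<times> f, f] \<in> paths P"
    using c e f s t
    by (simp_all add: paths_def proj_rel_def star_closed times_closed
        star_star_same times_times_same)
qed

text \<open>
  The middle entry of the first pushed path is \<open>(e \<star> p) \<times> (f \<times> q)\<close>, and
  \<open>times_star_interchange\<close> rewrites it to \<open>e' \<star> p\<close>. So a swap generator is pushed to the swap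
  generator of \<open>(e', p, f \<times> q)\<close>.
\<close>

lemma push_left_admissible:
  assumes "admissible P e p f" "q \<in> carrier P"
  defines "e' \<equiv> e \<^bold>\<times> (p \<^bold>\<times> (f \<^bold>\<times> q))"
  shows "admissible P e' p (f \<^bold>\<times> q)"
    and "push_left P [e, e \<star> p, f] q = [e', e' \<star> p, f \<^bold>\<times> q]"
    and "push_left P [e, p \<^bold>\<times> f, f] q = [e', p \<^bold>\<times> (f \<^bold>\<times> q), f \<^bold>\<times> q]"
proof -
  have c: "e \<in> carrier P" "p \<in> carrier P" "f \<in> carrier P" "f \<^bold>\<times> q \<in> carrier P"
    "e \<star> p \<in> carrier P" "p \<^bold>\<times> (f \<^bold>\<times> q) \<in> carrier P"
    using assms(1,2) by (auto simp: admissible_def times_closed star_closed)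
  have s: "e' \<star> p = (e \<star> p) \<^bold>\<times> (f \<^bold>\<times> q)"
    using times_star_interchange[of e p "f \<^bold>\<times> q"] c by (simp add: e'_def)
  have "\<F> (e \<star> p) f" using admissible_paths(1)[OF assms(1)] by (simp add: paths_def)
  then have "(e' \<star> p) \<star> (f \<^bold>\<times> q) = f \<^bold>\<times> q"
    using proj_rel_star_times[of "e \<star> p" f q] c assms(2)
    by (simp add: s times_star_eq_star)
  moreover have "e' \<^bold>\<times> (p \<^bold>\<times> (f \<^bold>\<times> q)) = e'"
    using c by (simp add: e'_def times_times_same)
  ultimately show "admissible P e' p (f \<^bold>\<times> q)"
    using c by (simp add: admissible_def e'_def times_closed)
  show "push_left P [e, e \<star> p, f] q = [e', e' \<star> p, f \<^bold>\<times> q]"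
    using P3_times[of "f \<^bold>\<times> q" p e] c by (simp add: s) (simp add: e'_def)
  show "push_left P [e, p \<^bold>\<times> f, f] q = [e', p \<^bold>\<times> (f \<^bold>\<times> q), f \<^bold>\<times> q]"
    using L3[of p f q] c assms(2) by (simp add: e'_def)
qed

lemma push_right_admissible:
  assumes "admissible P e p f" "q \<in> carrier P"
  defines "f' \<equiv> ((q \<star> e) \<star> p) \<star> f"
  shows "admissible P (q \<star> e) p f'"
    and "push_right P q [e, e \<star> p, f] = [q \<star> e, (q \<star> e) \<star> p, f']"
    and "push_right P q [e, p \<^bold>\<times> f, f] = [q \<star> e, p \<^bold>\<times> f', f']"
proof -
  have c: "e \<in> carrier P" "p \<in> carrier P" "f \<in> carrier P" "q \<star> e \<in> carrier P"
    "p \<^bold>\<times> f \<in> carrier P" "(q \<star> e) \<star> p \<in> carrier P"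
    using assms(1,2) by (auto simp: admissible_def times_closed star_closed)
  have t: "p \<^bold>\<times> f' = (q \<star> e) \<star> (p \<^bold>\<times> f)"
    using star_times_interchange[of "q \<star> e" p f] c by (simp add: f'_def)
  have "\<F> e (p \<^bold>\<times> f)" using admissible_paths(2)[OF assms(1)] by (simp add: paths_def)
  then have "(q \<star> e) \<^bold>\<times> (p \<^bold>\<times> f') = q \<star> e"
    using proj_rel_times_star_right[of e "p \<^bold>\<times> f" q] c assms(2)
    by (simp add: t times_star_eq_times)
  moreover have "((q \<star> e) \<star> p) \<star> f' = f'"
    using c by (simp add: f'_def star_star_same)
  ultimately show "admissible P (q \<star> e) p f'"
    using c by (simp add: admissible_def f'_def star_closed)
  show "push_right P q [e, e \<star> p, f] = [q \<star> e, (q \<star> e) \<star> p, f']"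
    using R3[of p e q] c assms(2) by (simp add: f'_def)
  show "push_right P q [e, p \<^bold>\<times> f, f] = [q \<star> e, p \<^bold>\<times> f', f']"
    using P3_star[of "q \<star> e" p f] c by (simp add: t) (simp add: f'_def)
qed

text \<open>
  Here and in \<open>path_congruenceD\<close> the clauses of \<^const>\<open>path_congruence\<close> become rules without bounded
  quantifiers over pairs, so that membership in the intersection \<^const>\<open>chain_rel\<close> can be
  handled one clause at a time.
\<close>

lemma path_congruenceI:
  assumes "equiv (paths P) R"
    and "\<And>ps qs. (ps, qs) \<in> R \<Longrightarrow> hd ps = hd qs \<and> last ps = last qs"
    and "\<And>ps qs us. (ps, qs) \<in> R \<Longrightarrow> us \<in> paths P \<Longrightarrow> last us = hd ps \<Longrightarrow>
          (path_comp us ps, path_comp us qs) \<in> R"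
    and "\<And>ps qs us. (ps, qs) \<in> R \<Longrightarrow> us \<in> paths P \<Longrightarrow> last ps = hd us \<Longrightarrow>
          (path_comp ps us, path_comp qs us) \<in> R"
  shows "path_congruence P R"
  unfolding path_congruence_def using assms by (intro conjI; (assumption | blast))

lemma path_congruenceD:
  assumes "path_congruence P R"
  shows "equiv (paths P) R"
    and "(ps, qs) \<in> R \<Longrightarrow> us \<in> paths P \<Longrightarrow> last us = hd ps \<Longrightarrow>
          (path_comp us ps, path_comp us qs) \<in> R"
    and "(ps, qs) \<in> R \<Longrightarrow> us \<in> paths P \<Longrightarrow> last ps = hd us \<Longrightarrow>
          (path_comp ps us, path_comp qs us) \<in> R"
  using assms unfolding path_congruence_def by auto

lemma same_ends_congruence:
  "path_congruence P {(ps, qs) \<in> paths P \<times> paths P. hd ps = hd qs \<and> last ps = last qs}"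
proof (rule path_congruenceI)
  show "equiv (paths P) {(ps, qs) \<in> paths P \<times> paths P. hd ps = hd qs \<and> last ps = last qs}"
    by (rule equivI) (auto simp: refl_on_def intro!: symI transI)
qed (auto simp: path_comp_path hd_path_comp last_path_comp not_Nil_path)

lemma generators_same_ends:
  "chain_generators P \<subseteq> {(ps, qs) \<in> paths P \<times> paths P. hd ps = hd qs \<and> last ps = last qs}"
proof -
  have "[p, p] \<in> paths P" "[p] \<in> paths P" if "p \<in> carrier P" for p
    using that by (simp_all add: paths_def proj_rel_def L1 R1)
  then show ?thesis
    using admissible_paths by (auto simp: chain_generators_def)
qed

text \<open>
  Having the same end points is itself a path congruence that contains the generators, so it
  contains \<^const>\<open>chain_rel\<close>.
\<close>

lemma chain_rel_same_ends:
  assumes "(ps, qs) \<in> chain_rel P"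
  shows "ps \<in> paths P" "qs \<in> paths P" "hd ps = hd qs" "last ps = last qs"
proof -
  have "(ps, qs) \<in> {(ps, qs) \<in> paths P \<times> paths P. hd ps = hd qs \<and> last ps = last qs}"
    using assms same_ends_congruence generators_same_ends unfolding chain_rel_def by blast
  then show "ps \<in> paths P" "qs \<in> paths P" "hd ps = hd qs" "last ps = last qs" by auto
qed

lemma chain_relI:
  "(\<And>R. path_congruence P R \<Longrightarrow> chain_generators P \<subseteq> R \<Longrightarrow> x \<in> R) \<Longrightarrow> x \<in> chain_rel P"
  by (simp add: chain_rel_def)

lemma chain_relD:
  "x \<in> chain_rel P \<Longrightarrow> path_congruence P R \<Longrightarrow> chain_generators P \<subseteq> R \<Longrightarrow> x \<in> R"
  by (simp add: chain_rel_def)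

lemma chain_rel_refl: "ps \<in> paths P \<Longrightarrow> (ps, ps) \<in> chain_rel P"
  by (rule chain_relI) (meson path_congruenceD(1) equiv_def refl_onD)

lemma chain_rel_sym: "(ps, qs) \<in> chain_rel P \<Longrightarrow> (qs, ps) \<in> chain_rel P"
  by (rule chain_relI) (meson chain_relD path_congruenceD(1) equiv_def symD)

lemma chain_rel_trans:
  assumes "(ps, qs) \<in> chain_rel P" "(qs, rs) \<in> chain_rel P"
  shows "(ps, rs) \<in> chain_rel P"
proof (rule chain_relI)
  fix R assume R: "path_congruence P R" "chain_generators P \<subseteq> R"
  then have "trans R" by (meson path_congruenceD(1) equiv_def)
  then show "(ps, rs) \<in> R"
    using chain_relD[OF assms(1) R] chain_relD[OF assms(2) R] by (rule transD)
qed

lemma chain_rel_equiv: "equiv (paths P) (chain_rel P)"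
  by (rule equivI)
     (auto simp: refl_on_def chain_rel_refl chain_rel_same_ends
        intro!: symI transI intro: chain_rel_sym chain_rel_trans)

lemma chain_rel_left:
  assumes "(ps, qs) \<in> chain_rel P" "us \<in> paths P" "last us = hd ps"
  shows "(path_comp us ps, path_comp us qs) \<in> chain_rel P"
  by (rule chain_relI) (rule path_congruenceD(2)[OF _ chain_relD[OF assms(1)] assms(2,3)])

lemma chain_rel_right:
  assumes "(ps, qs) \<in> chain_rel P" "us \<in> paths P" "last ps = hd us"
  shows "(path_comp ps us, path_comp qs us) \<in> chain_rel P"
  by (rule chain_relI) (rule path_congruenceD(3)[OF _ chain_relD[OF assms(1)] assms(2,3)])

lemma chain_rel_idem: "p \<in> carrier P \<Longrightarrow> ([p, p], [p]) \<in> chain_rel P"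
  by (rule chain_relI) (auto simp: chain_generators_def)

lemma chain_rel_swap:
  "admissible P e p f \<Longrightarrow> ([e, e \<star> p, f], [e, p \<^bold>\<times> f, f]) \<in> chain_rel P"
  by (rule chain_relI) (unfold chain_generators_def, blast)

text \<open>
  Rule induction for \<^const>\<open>chain_rel\<close>, which is defined as an intersection. The congruence
  hypotheses are available in the inductive cases because the path congruence
  to which minimality is applied is the part of \<^const>\<open>chain_rel\<close> on which \<open>Q\<close> holds.
\<close>

lemma chain_rel_induct [consumes 1, case_names refl sym trans left right idem swap]:
  assumes "(ps, qs) \<in> chain_rel P"
    and refl: "\<And>ps. ps \<in> paths P \<Longrightarrow> Q ps ps"
    and sym: "\<And>ps qs. (ps, qs) \<in> chain_rel P \<Longrightarrow> Q ps qs \<Longrightarrow> Q qs ps"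
    and trans: "\<And>ps qs rs. (ps, qs) \<in> chain_rel P \<Longrightarrow> (qs, rs) \<in> chain_rel P \<Longrightarrow>
          Q ps qs \<Longrightarrow> Q qs rs \<Longrightarrow> Q ps rs"
    and left: "\<And>ps qs us. (ps, qs) \<in> chain_rel P \<Longrightarrow> Q ps qs \<Longrightarrow> us \<in> paths P \<Longrightarrow>
          last us = hd ps \<Longrightarrow> Q (path_comp us ps) (path_comp us qs)"
    and right: "\<And>ps qs us. (ps, qs) \<in> chain_rel P \<Longrightarrow> Q ps qs \<Longrightarrow> us \<in> paths P \<Longrightarrow>
          last ps = hd us \<Longrightarrow> Q (path_comp ps us) (path_comp qs us)"
    and idem: "\<And>p. p \<in> carrier P \<Longrightarrow> Q [p, p] [p]"
    and swap: "\<And>e p f. admissible P e p f \<Longrightarrow> Q [e, e \<star> p, f] [e, p \<^bold>\<times> f, f]"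
  shows "Q ps qs"
proof -
  let ?R = "{(ps, qs). (ps, qs) \<in> chain_rel P \<and> Q ps qs}"
  have "path_congruence P ?R"
  proof (rule path_congruenceI)
    show "equiv (paths P) ?R"
    proof (rule equivI)
      show "refl_on (paths P) ?R"
        by (simp add: refl_on_def refl chain_rel_refl)
      show "?R \<subseteq> paths P \<times> paths P" using chain_rel_same_ends(1,2) by auto
      show "sym ?R" by (rule symI) (simp add: sym chain_rel_sym)
      show "trans ?R"
        by (rule transI) (auto intro: trans chain_rel_trans)
    qed
  qed (simp_all add: chain_rel_same_ends(3,4) left right chain_rel_left chain_rel_right)
  moreover have "chain_generators P \<subseteq> ?R"
    using idem swap chain_rel_idem chain_rel_swap by (auto simp: chain_generators_def)
  ultimately show ?thesis using chain_relD[OF assms(1), of ?R] by simp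
qed

text \<open>
  In the case \<open>left\<close>, the prefix \<open>us\<close> is pushed through the head of the pushed \<open>ps\<close>, which equals
  that of the pushed \<open>qs\<close> by the induction hypothesis. In the case \<open>right\<close>, it is \<open>ps\<close> and \<open>qs\<close> that
  are pushed through a new element, so the statement must hold for all \<open>q\<close> at once.
\<close>

lemma push_left_chain_rel:
  assumes "(ps, qs) \<in> chain_rel P" "q \<in> carrier P"
  shows "(push_left P ps q, push_left P qs q) \<in> chain_rel P"
  using assms
proof (induction arbitrary: q rule: chain_rel_induct)
  case (refl ps)
  then show ?case by (simp add: chain_rel_refl push_left_path)
next
  case (sym ps qs)
  then show ?case by (simp add: chain_rel_sym)
next
  case (trans ps qs rs)
  then show ?case by (blast intro: chain_rel_trans)
next
  case (left ps qs us)
  note ends = chain_rel_same_ends[OF left(1)]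
  have IH: "(push_left P ps q, push_left P qs q) \<in> chain_rel P" using left by simp
  note ends' = chain_rel_same_ends[OF IH]
  let ?r = "hd (push_left P ps q)"
  have "push_left P us ?r \<in> paths P"
    using left ends' by (simp add: push_left_path hd_path)
  moreover have "last (push_left P us ?r) = ?r"
    using left ends hd_push_left_absorb[of ps q] by (simp add: last_push_left paths_def)
  ultimately show ?case
    using chain_rel_left[OF IH] push_left_path_comp[of us _ q] left ends ends' by simp
next
  case (right ps qs us)
  note ends = chain_rel_same_ends[OF right(1)]
  let ?r = "hd (push_left P us q)"
  have us: "push_left P us q \<in> paths P" using right by (simp add: push_left_path)
  then have "(push_left P ps ?r, push_left P qs ?r) \<in> chain_rel P"
    using right by (simp add: hd_path)
  moreover have "last (push_left P ps ?r) = ?r"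
    using right ends hd_push_left_absorb[of us q] by (simp add: last_push_left paths_def)
  ultimately show ?case
    using chain_rel_right us push_left_path_comp[of _ us q] right ends by simp
next
  case (idem p)
  then show ?case
    using chain_rel_idem[of "p \<^bold>\<times> q"] by (simp add: times_closed times_absorb)
next
  case (swap e p f)
  then show ?case
    using push_left_admissible chain_rel_swap by metis
qed

lemma push_right_chain_rel:
  assumes "(ps, qs) \<in> chain_rel P" "q \<in> carrier P"
  shows "(push_right P q ps, push_right P q qs) \<in> chain_rel P"
  using assms
proof (induction arbitrary: q rule: chain_rel_induct)
  case (refl ps)
  then show ?case by (simp add: chain_rel_refl push_right_path)
next
  case (sym ps qs)
  then show ?case by (simp add: chain_rel_sym)
next
  case (trans ps qs rs)
  then show ?case by (blast intro: chain_rel_trans)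
next
  case (left ps qs us)
  note ends = chain_rel_same_ends[OF left(1)]
  let ?r = "last (push_right P q us)"
  have us: "push_right P q us \<in> paths P" using left by (simp add: push_right_path)
  then have "(push_right P ?r ps, push_right P ?r qs) \<in> chain_rel P"
    using left by (simp add: last_path)
  moreover have "hd (push_right P ?r ps) = ?r"
    using left ends last_push_right_absorb[of us q] by (simp add: hd_push_right paths_def)
  ultimately show ?case
    using chain_rel_left us push_right_path_comp[of us _ q] left ends by simp
next
  case (right ps qs us)
  note ends = chain_rel_same_ends[OF right(1)]
  have IH: "(push_right P q ps, push_right P q qs) \<in> chain_rel P" using right by simp
  note ends' = chain_rel_same_ends[OF IH]
  let ?r = "last (push_right P q ps)"
  have "push_right P ?r us \<in> paths P"
    using right ends' by (simp add: push_right_path last_path)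
  moreover have "hd (push_right P ?r us) = ?r"
    using right ends last_push_right_absorb[of ps q] by (simp add: hd_push_right paths_def)
  ultimately show ?case
    using chain_rel_right[OF IH] push_right_path_comp[of _ us q] right ends ends' by simp
next
  case (idem p)
  then show ?case
    using chain_rel_idem[of "q \<star> p"] by (simp add: star_closed star_absorb)
next
  case (swap e p f)
  then show ?case
    using push_right_admissible chain_rel_swap by metis
qed

text \<open>
  Congruent paths have the same end points, so the elements through which the other factor is pushed
  do not change. The two pushed halves are glued by the two-element path \<open>?m\<close>, which turns the
  concatenation of lists into a composition of paths.
\<close>

lemma path_prod_chain_rel:
  assumes "(ps, ps') \<in> chain_rel P" "(qs, qs') \<in> chain_rel P"
  shows "(path_prod P ps qs, path_prod P ps' qs') \<in> chain_rel P"
proof -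
  note ends = chain_rel_same_ends[OF assms(1)] chain_rel_same_ends[OF assms(2)]
  define q p where "q = hd qs" and "p = last ps"
  have c: "q \<in> carrier P" "p \<in> carrier P"
    using ends by (auto simp: p_def q_def hd_path last_path)
  have L: "(push_left P ps q, push_left P ps' q) \<in> chain_rel P"
    and R: "(push_right P p qs, push_right P p qs') \<in> chain_rel P"
    using assms c by (simp_all add: push_left_chain_rel push_right_chain_rel)
  note Le = chain_rel_same_ends[OF L] and Re = chain_rel_same_ends[OF R]
  let ?m = "[p \<^bold>\<times> q, p \<star> q]"
  have m: "?m \<in> paths P"
    using c proj_rel_times_star by (simp add: paths_def times_closed star_closed)
  have l: "last (push_left P ps q) = hd ?m"
    using ends by (simp add: p_def last_push_left paths_def)
  have r: "hd (push_right P p qs) = last ?m"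
    using ends by (simp add: q_def hd_push_right paths_def)
  have Lm: "(path_comp (push_left P ps q) ?m, path_comp (push_left P ps' q) ?m) \<in> chain_rel P"
    using chain_rel_right[OF L m l] .
  note Lme = chain_rel_same_ends[OF Lm]
  have lm: "last (path_comp xs ?m) = p \<star> q" for xs
    by (simp add: path_comp_def)
  have glue: "path_comp (path_comp xs ?m) ys = xs @ ys"
    if "ys \<in> paths P" "hd ys = p \<star> q" for xs ys
    using that by (cases ys) (auto simp: path_comp_def paths_def)
  have "(path_comp (path_comp (push_left P ps q) ?m) (push_right P p qs),
         path_comp (path_comp (push_left P ps' q) ?m) (push_right P p qs)) \<in> chain_rel P"
    using chain_rel_right[OF Lm Re(1)] r lm by simp
  moreover have "(path_comp (path_comp (push_left P ps' q) ?m) (push_right P p qs),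
         path_comp (path_comp (push_left P ps' q) ?m) (push_right P p qs')) \<in> chain_rel P"
    using chain_rel_left[OF R Lme(2)] r lm by simp
  ultimately have "(push_left P ps q @ push_right P p qs,
      push_left P ps' q @ push_right P p qs') \<in> chain_rel P"
    using chain_rel_trans r Re glue[OF Re(1)] glue[OF Re(2)] by simp
  then show ?thesis
    using ends by (simp add: path_prod_def p_def q_def)
qed

lemma mem_chain_class_iff: "qs \<in> chain_class P ps \<longleftrightarrow> (ps, qs) \<in> chain_rel P"
  by (simp add: chain_class_def)

lemma chain_class_eq:
  "(ps, qs) \<in> chain_rel P \<Longrightarrow> chain_class P ps = chain_class P qs"
  unfolding chain_class_def using chain_rel_equiv by (rule equiv_class_eq)

text \<open>
  The operations of the chain semigroup are unions over all representatives; such a union collapses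
  when its members agree.
\<close>

lemma Union_chain_class:
  assumes "ps \<in> paths P"
    and eq: "\<And>qs. (ps, qs) \<in> chain_rel P \<Longrightarrow> f qs = c"
  shows "(\<Union>qs\<in>chain_class P ps. f qs) = c"
proof -
  have "ps \<in> chain_class P ps" using assms(1) by (simp add: mem_chain_class_iff chain_rel_refl)
  then have "(\<Union>qs\<in>chain_class P ps. f qs) = (\<Union>qs\<in>chain_class P ps. c)"
    using eq by (simp add: mem_chain_class_iff)
  then show ?thesis using \<open>ps \<in> chain_class P ps\<close> by auto
qed

lemma carrier_chain_semigroup:
  "X \<in> carrier (chain_semigroup P) \<longleftrightarrow> (\<exists>ps\<in>paths P. X = chain_class P ps)"
  by (auto simp: chain_semigroup_def chain_class_def quotient_def)

lemma chain_class_mult: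
  assumes "ps \<in> paths P" "qs \<in> paths P"
  shows "chain_class P ps \<cdot>\<^bsub>chain_semigroup P\<^esub> chain_class P qs = chain_class P (path_prod P ps qs)"
proof -
  have "(\<Union>ps'\<in>chain_class P ps. \<Union>qs'\<in>chain_class P qs. chain_class P (path_prod P ps' qs'))
      = chain_class P (path_prod P ps qs)"
    using assms by (intro Union_chain_class)
      (simp_all add: chain_class_eq[OF path_prod_chain_rel[THEN chain_rel_sym]])
  then show ?thesis by (simp add: chain_semigroup_def)
qed

lemma chain_class_plus:
  assumes "ps \<in> paths P"
  shows "(chain_class P ps)\<^sup>+\<^bsub>chain_semigroup P\<^esub> = chain_class P [hd ps]"
  using Union_chain_class[OF assms, of "\<lambda>ps. chain_class P [hd ps]"] chain_rel_same_ends(3)[of ps]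
  by (simp add: chain_semigroup_def)

lemma chain_class_star:
  assumes "ps \<in> paths P"
  shows "(chain_class P ps)\<^sup>*\<^bsub>chain_semigroup P\<^esub> = chain_class P [last ps]"
  using Union_chain_class[OF assms, of "\<lambda>ps. chain_class P [last ps]"] chain_rel_same_ends(4)[of ps]
  by (simp add: chain_semigroup_def)

end

section \<open>Products of projections in a DRC semigroup\<close>

lemma carrier_projections: "carrier (projections S) = {x\<^sup>+\<^bsub>S\<^esub> | x. x \<in> carrier S}"
  and times_projections: "e \<^bold>\<times>\<^bsub>projections S\<^esub> f = (e \<cdot>\<^bsub>S\<^esub> f)\<^sup>+\<^bsub>S\<^esub>"
  and star_projections: "e \<star>\<^bsub>projections S\<^esub> f = (e \<cdot>\<^bsub>S\<^esub> f)\<^sup>*\<^bsub>S\<^esub>"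
  by (simp_all add: projections_def)

context drc_semigroup
begin

abbreviation Proj where "Proj \<equiv> carrier (projections S)"

lemma proj_closed: "e \<in> Proj \<Longrightarrow> e \<in> carrier S"
  and proj_plus: "e \<in> Proj \<Longrightarrow> e\<^sup>+ = e"
  and proj_star: "e \<in> Proj \<Longrightarrow> e\<^sup>* = e"
  and proj_idem: "e \<in> Proj \<Longrightarrow> e \<cdot> e = e"
  using plus_mult by (auto simp: carrier_projections plus_closed plus_plus plus_star)
    (metis plus_closed plus_plus)

lemma plus_proj: "x \<in> carrier S \<Longrightarrow> x\<^sup>+ \<in> Proj"
  by (auto simp: carrier_projections)

lemma star_proj: "x \<in> carrier S \<Longrightarrow> x\<^sup>* \<in> Proj"
  unfolding carrier_projections by (metis (mono_tags, lifting) mem_Collect_eq star_closed star_plus)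

lemma plus_mult_proj_right:
  assumes "e \<in> Proj" "y \<in> carrier S"
  shows "(e \<cdot> y)\<^sup>+ \<cdot> e = (e \<cdot> y)\<^sup>+"
proof -
  have c: "e \<in> carrier S" "(e \<cdot> y)\<^sup>+ \<in> carrier S"
    using assms by (simp_all add: proj_closed mult_closed plus_closed)
  have eq: "(e \<cdot> y)\<^sup>+ = e \<cdot> (e \<cdot> y)\<^sup>+ \<cdot> e"
    using plus_le[of e y] assms c by (simp add: proj_plus)
  have "e \<cdot> (e \<cdot> y)\<^sup>+ \<cdot> e \<cdot> e = e \<cdot> (e \<cdot> y)\<^sup>+ \<cdot> e"
    using c assms by (simp add: mult_assoc mult_closed proj_idem)
  then show ?thesis using eq by simp
qed

lemma star_mult_proj_left:
  assumes "f \<in> Proj" "x \<in> carrier S"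
  shows "f \<cdot> (x \<cdot> f)\<^sup>* = (x \<cdot> f)\<^sup>*"
proof -
  have c: "f \<in> carrier S" "(x \<cdot> f)\<^sup>* \<in> carrier S"
    using assms by (simp_all add: proj_closed mult_closed star_closed)
  have eq: "(x \<cdot> f)\<^sup>* = f \<cdot> (x \<cdot> f)\<^sup>* \<cdot> f"
    using star_le[of x f] assms c by (simp add: proj_star)
  have "f \<cdot> (f \<cdot> (x \<cdot> f)\<^sup>* \<cdot> f) = f \<cdot> (x \<cdot> f)\<^sup>* \<cdot> f"
    using c assms by (simp add: mult_closed proj_idem flip: mult_assoc)
  then show ?thesis using eq by simp
qed

text \<open>
  \<open>(e y)\<^sup>+ y = (e y)\<^sup>+ e y = e y\<close>, as \<open>(e y)\<^sup>+\<close> absorbs \<open>e\<close>.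
\<close>

lemma plus_mult_right_factor:
  assumes "e \<in> Proj" "y \<in> carrier S"
  shows "(e \<cdot> y)\<^sup>+ \<cdot> y = e \<cdot> y"
proof -
  have c: "e \<in> carrier S" "(e \<cdot> y)\<^sup>+ \<in> carrier S"
    using assms by (simp_all add: proj_closed mult_closed plus_closed)
  have "(e \<cdot> y)\<^sup>+ \<cdot> y = ((e \<cdot> y)\<^sup>+ \<cdot> e) \<cdot> y"
    using plus_mult_proj_right assms by simp
  also have "\<dots> = (e \<cdot> y)\<^sup>+ \<cdot> (e \<cdot> y)" using c assms by (simp add: mult_assoc)
  also have "\<dots> = e \<cdot> y" using c assms by (simp add: plus_mult mult_closed)
  finally show ?thesis .
qed

lemma left_factor_mult_star:
  assumes "f \<in> Proj" "x \<in> carrier S"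
  shows "x \<cdot> (x \<cdot> f)\<^sup>* = x \<cdot> f"
proof -
  have c: "f \<in> carrier S" "(x \<cdot> f)\<^sup>* \<in> carrier S"
    using assms by (simp_all add: proj_closed mult_closed star_closed)
  have "x \<cdot> (x \<cdot> f)\<^sup>* = x \<cdot> (f \<cdot> (x \<cdot> f)\<^sup>*)"
    using star_mult_proj_left assms by simp
  also have "\<dots> = (x \<cdot> f) \<cdot> (x \<cdot> f)\<^sup>*" using c assms by (simp add: mult_assoc)
  also have "\<dots> = x \<cdot> f" using c assms by (simp add: mult_star mult_closed)
  finally show ?thesis .
qed

lemma plus_mult_star_proj:
  assumes "e \<in> Proj" "f \<in> Proj"
  shows "(e \<cdot> f)\<^sup>+ \<cdot> (e \<cdot> f)\<^sup>* = e \<cdot> f"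
proof -
  have c: "e \<in> carrier S" "f \<in> carrier S" "(e \<cdot> f)\<^sup>+ \<in> carrier S" "(e \<cdot> f)\<^sup>* \<in> carrier S"
    using assms by (simp_all add: proj_closed mult_closed plus_closed star_closed)
  have "(e \<cdot> f)\<^sup>+ \<cdot> (e \<cdot> f)\<^sup>* = (e \<cdot> f)\<^sup>+ \<cdot> (f \<cdot> (e \<cdot> f)\<^sup>*)"
    using star_mult_proj_left assms c by simp
  also have "\<dots> = ((e \<cdot> f)\<^sup>+ \<cdot> f) \<cdot> (e \<cdot> f)\<^sup>*"
    using c by (simp add: mult_assoc)
  also have "\<dots> = e \<cdot> f"
    using assms c by (simp add: plus_mult_right_factor mult_star mult_closed)
  finally show ?thesis .
qed

lemma drc_prod_single [simp]: "drc_prod S [x] = x"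
  by (simp add: drc_prod_def)

lemma foldl_mult_closed:
  "a \<in> carrier S \<Longrightarrow> set xs \<subseteq> carrier S \<Longrightarrow> foldl (\<cdot>) a xs \<in> carrier S"
  by (induction xs arbitrary: a) (auto simp: mult_closed)

lemma foldl_mult_assoc:
  "a \<in> carrier S \<Longrightarrow> b \<in> carrier S \<Longrightarrow> set xs \<subseteq> carrier S \<Longrightarrow>
     foldl (\<cdot>) (a \<cdot> b) xs = a \<cdot> foldl (\<cdot>) b xs"
  by (induction xs arbitrary: b) (auto simp: mult_closed mult_assoc)

lemma drc_prod_closed:
  "xs \<noteq> [] \<Longrightarrow> set xs \<subseteq> carrier S \<Longrightarrow> drc_prod S xs \<in> carrier S"
  by (cases xs) (auto simp: drc_prod_def foldl_mult_closed)

lemma drc_prod_Cons: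
  assumes "xs \<noteq> []" "set xs \<subseteq> carrier S" "x \<in> carrier S"
  shows "drc_prod S (x # xs) = x \<cdot> drc_prod S xs"
  using assms by (cases xs) (auto simp: drc_prod_def foldl_mult_assoc)

lemma drc_prod_append:
  assumes "xs \<noteq> []" "ys \<noteq> []" "set xs \<subseteq> carrier S" "set ys \<subseteq> carrier S"
  shows "drc_prod S (xs @ ys) = drc_prod S xs \<cdot> drc_prod S ys"
  using assms
proof (induction xs)
  case (Cons x xs)
  then show ?case
    by (cases "xs = []") (auto simp: drc_prod_Cons drc_prod_closed mult_assoc)
qed simp

lemma hd_drc_prod:
  assumes "xs \<noteq> []" "set xs \<subseteq> carrier S" "hd xs \<in> Proj"
  shows "hd xs \<cdot> drc_prod S xs = drc_prod S xs"
proof -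
  obtain x ys where xs: "xs = x # ys" using assms by (cases xs) auto
  show ?thesis
    using assms xs
    by (cases "ys = []") (auto simp: drc_prod_Cons drc_prod_closed proj_idem simp flip: mult_assoc)
qed

lemma drc_prod_last:
  assumes "xs \<noteq> []" "set xs \<subseteq> carrier S" "last xs \<in> Proj"
  shows "drc_prod S xs \<cdot> last xs = drc_prod S xs"
proof -
  obtain x ys where xs: "xs = ys @ [x]" using assms by (cases xs rule: rev_cases) auto
  show ?thesis
    using assms xs
    by (cases "ys = []") (auto simp: drc_prod_append drc_prod_closed proj_idem mult_assoc)
qed

lemma Proj_list_closed: "set es \<subseteq> Proj \<Longrightarrow> set es \<subseteq> carrier S"
  using proj_closed by blast

lemma push_left_proj:
  "set es \<subseteq> Proj \<Longrightarrow> f \<in> Proj \<Longrightarrow> set (push_left (projections S) es f) \<subseteq> Proj"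
proof (induction es)
  case (Cons e es)
  let ?L = "push_left (projections S) es f"
  have "hd (?L @ [f]) \<in> Proj" using Cons by (cases ?L) auto
  then show ?case
    using Cons by (simp add: times_projections plus_proj mult_closed proj_closed)
qed simp

lemma push_right_proj:
  "set fs \<subseteq> Proj \<Longrightarrow> e \<in> Proj \<Longrightarrow> set (push_right (projections S) e fs) \<subseteq> Proj"
  by (induction fs arbitrary: e) (auto simp: star_projections star_proj mult_closed proj_closed)

text \<open>
  Pushing replaces each entry \<open>e\<close> by \<open>(e r)\<^sup>+\<close>, where \<open>r\<close> is the next pushed entry. Since \<open>r\<close> can be
  duplicated and \<open>(e r)\<^sup>+ r = e r\<close>, the product with \<open>f\<close> at the end is unaffected.
\<close>

lemma drc_prod_push_left:
  assumes "es \<noteq> []" "set es \<subseteq> Proj" "f \<in> Proj"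
  shows "drc_prod S (push_left (projections S) es f) \<cdot> f = drc_prod S es \<cdot> f"
  using assms
proof (induction es)
  case (Cons e es)
  show ?case
  proof (cases "es = []")
    case True
    then show ?thesis
      using Cons.prems by (simp add: times_projections plus_mult_right_factor proj_closed)
  next
    case False
    let ?L = "push_left (projections S) es f"
    let ?r = "hd ?L"
    have L: "set ?L \<subseteq> Proj" "?L \<noteq> []" using Cons.prems False by (simp_all add: push_left_proj)
    then have r: "?r \<in> Proj" using hd_in_set by blast
    have c: "e \<in> carrier S" "f \<in> carrier S" "?r \<in> carrier S" "drc_prod S ?L \<in> carrier S"
      "drc_prod S es \<in> carrier S" "(e \<cdot> ?r)\<^sup>+ \<in> carrier S"
      using Cons.prems L r False
      by (simp_all add: proj_closed drc_prod_closed Proj_list_closed plus_closed mult_closed)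
    have hd: "?r \<cdot> drc_prod S ?L = drc_prod S ?L"
      using L r by (simp add: hd_drc_prod Proj_list_closed)
    have "(e \<cdot> ?r)\<^sup>+ \<cdot> drc_prod S ?L = ((e \<cdot> ?r)\<^sup>+ \<cdot> ?r) \<cdot> drc_prod S ?L"
      using hd c by (simp add: mult_assoc)
    also have "\<dots> = e \<cdot> drc_prod S ?L"
      using Cons.prems c hd by (simp add: plus_mult_right_factor mult_assoc)
    finally have "drc_prod S (push_left (projections S) (e # es) f) = e \<cdot> drc_prod S ?L"
      using L c by (simp add: times_projections drc_prod_Cons Proj_list_closed)
    then show ?thesis
      using Cons False c by (simp add: mult_assoc drc_prod_Cons Proj_list_closed)
  qed
qed simp

lemma drc_prod_push_right:
  assumes "fs \<noteq> []" "set fs \<subseteq> Proj" "e \<in> Proj"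
  shows "e \<cdot> drc_prod S (push_right (projections S) e fs) = e \<cdot> drc_prod S fs"
  using assms
proof (induction fs arbitrary: e)
  case (Cons f fs)
  have ef: "e \<cdot> (e \<cdot> f)\<^sup>* = e \<cdot> f"
    using Cons.prems by (simp add: left_factor_mult_star proj_closed)
  show ?case
  proof (cases "fs = []")
    case True
    then show ?thesis using ef by (simp add: star_projections)
  next
    case False
    let ?g = "(e \<cdot> f)\<^sup>*"
    let ?R = "push_right (projections S) ?g fs"
    have g: "?g \<in> Proj" using Cons.prems by (simp add: star_proj mult_closed proj_closed)
    have R: "set ?R \<subseteq> Proj" "?R \<noteq> []" using Cons.prems False g by (simp_all add: push_right_proj)
    have c: "e \<in> carrier S" "f \<in> carrier S" "?g \<in> carrier S" "drc_prod S ?R \<in> carrier S"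
      "drc_prod S fs \<in> carrier S"
      using Cons.prems R g False by (simp_all add: proj_closed drc_prod_closed Proj_list_closed)
    have IH: "?g \<cdot> drc_prod S ?R = ?g \<cdot> drc_prod S fs"
      using Cons.IH[OF False] Cons.prems g by simp
    have "e \<cdot> drc_prod S (push_right (projections S) e (f # fs)) = e \<cdot> (?g \<cdot> drc_prod S ?R)"
      using R c by (simp add: star_projections drc_prod_Cons Proj_list_closed)
    also have "\<dots> = (e \<cdot> ?g) \<cdot> drc_prod S fs" using IH c by (simp add: mult_assoc)
    also have "\<dots> = e \<cdot> drc_prod S (f # fs)"
      using ef c False Cons.prems by (simp add: mult_assoc drc_prod_Cons Proj_list_closed)
    finally show ?thesis .
  qed
qed simp

text \<open>
  With \<open>e\<close>, \<open>f\<close> the entries at the junction and \<open>A\<close>, \<open>B\<close> the products of the pushed lists, \<open>A\<close> ends in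
  \<open>(e f)\<^sup>+\<close> and \<open>B\<close> starts with \<open>(e f)\<^sup>*\<close>. Thus \<open>A B = A e f B\<close>, where \<open>A e = A\<close> and
  \<open>f B = B\<close>. Since \<open>A f\<close> is the first product times \<open>f\<close>, the pushing on the left can be undone; what
  remains is the first product, which ends in \<open>e\<close>, times \<open>B\<close>, and \<open>e B\<close> is \<open>e\<close> times the second
  product.
\<close>

lemma drc_prod_path_prod:
  assumes "es \<noteq> []" "set es \<subseteq> Proj" "fs \<noteq> []" "set fs \<subseteq> Proj"
  shows "drc_prod S (path_prod (projections S) es fs) = drc_prod S es \<cdot> drc_prod S fs"
proof -
  define e f where "e = last es" and "f = hd fs"
  have ef: "e \<in> Proj" "f \<in> Proj" using assms by (auto simp: e_def f_def)
  let ?L = "push_left (projections S) es f" and ?R = "push_right (projections S) e fs"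
  have LR: "set ?L \<subseteq> Proj" "?L \<noteq> []" "set ?R \<subseteq> Proj" "?R \<noteq> []"
    using assms ef by (simp_all add: push_left_proj push_right_proj)
  let ?A = "drc_prod S ?L" and ?B = "drc_prod S ?R"
  let ?a = "(e \<cdot> f)\<^sup>+" and ?b = "(e \<cdot> f)\<^sup>*"
  have c: "e \<in> carrier S" "f \<in> carrier S" "?A \<in> carrier S" "?B \<in> carrier S"
    "drc_prod S es \<in> carrier S" "drc_prod S fs \<in> carrier S"
    "?a \<in> carrier S" "?b \<in> carrier S" "?a \<in> Proj" "?b \<in> Proj"
    using assms ef LR by (simp_all add: proj_closed drc_prod_closed Proj_list_closed plus_closed
        star_closed mult_closed plus_proj star_proj)
  have Aa: "?A \<cdot> ?a = ?A"
    using drc_prod_last[of ?L] LR c assms(1)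
    by (simp add: Proj_list_closed last_push_left times_projections flip: e_def)
  have bB: "?b \<cdot> ?B = ?B"
    using hd_drc_prod[of ?R] LR c assms(3)
    by (simp add: Proj_list_closed hd_push_right star_projections flip: f_def)
  have Ae: "?A \<cdot> e = ?A"
    using Aa plus_mult_proj_right[of e f] ef c by (metis mult_assoc)
  have fB: "f \<cdot> ?B = ?B"
    using bB star_mult_proj_left[of f e] ef c by (metis mult_assoc)
  have "drc_prod S (path_prod (projections S) es fs) = ?A \<cdot> ?B"
    using LR by (simp add: path_prod_def drc_prod_append Proj_list_closed flip: e_def f_def)
  also have "\<dots> = (?A \<cdot> ?a) \<cdot> (?b \<cdot> ?B)" using Aa bB by simp
  also have "\<dots> = ?A \<cdot> ((?a \<cdot> ?b) \<cdot> ?B)" using c by (simp add: mult_assoc mult_closed)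
  also have "\<dots> = (?A \<cdot> e) \<cdot> (f \<cdot> ?B)"
    using c ef by (simp add: plus_mult_star_proj mult_assoc mult_closed)
  also have "\<dots> = (?A \<cdot> f) \<cdot> ?B" using Ae c by (simp add: mult_assoc)
  also have "\<dots> = drc_prod S es \<cdot> ?B"
    using drc_prod_push_left[OF assms(1,2) ef(2)] fB c by (simp add: mult_assoc)
  also have "\<dots> = (drc_prod S es \<cdot> e) \<cdot> ?B"
    using drc_prod_last[of es] assms ef by (simp add: Proj_list_closed flip: e_def)
  also have "\<dots> = (drc_prod S es \<cdot> e) \<cdot> drc_prod S fs"
    using drc_prod_push_right[OF assms(3,4) ef(1)] c by (simp add: mult_assoc)
  also have "\<dots> = drc_prod S es \<cdot> drc_prod S fs"
    using drc_prod_last[of es] assms ef by (simp add: Proj_list_closed flip: e_def)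
  finally show ?thesis .
qed

text \<open>
  By congruence, \<open>(e x)\<^sup>+ = (e x\<^sup>+)\<^sup>+\<close>; here \<open>x\<^sup>+\<close> is the second entry by induction, and \<open>\<F>\<close> reduces
  the result to \<open>e\<close>.
\<close>

lemma drc_prod_plus:
  "es \<in> paths (projections S) \<Longrightarrow> (drc_prod S es)\<^sup>+ = hd es"
proof (induction es)
  case (Cons e es)
  show ?case
  proof (cases es)
    case Nil
    then show ?thesis using Cons.prems by (simp add: paths_def proj_plus)
  next
    case C: (Cons f fs)
    have es: "es \<in> paths (projections S)" and e: "e \<in> Proj" and ef: "(e \<cdot> f)\<^sup>+ = e"
      using Cons.prems C by (auto simp: paths_def proj_rel_def times_projections)
    have c: "es \<noteq> []" "set es \<subseteq> carrier S" "e \<in> carrier S"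
      using es e by (auto simp: paths_def proj_closed)
    have "(e \<cdot> drc_prod S es)\<^sup>+ = e"
      using plus_congr[of e "drc_prod S es"] Cons.IH[OF es] c ef C by (simp add: drc_prod_closed)
    then show ?thesis using c by (simp add: drc_prod_Cons)
  qed
qed (simp add: paths_def)

lemma drc_prod_star:
  "es \<in> paths (projections S) \<Longrightarrow> (drc_prod S es)\<^sup>* = last es"
proof (induction es rule: rev_induct)
  case (snoc e es)
  show ?case
  proof (cases "es = []")
    case True
    then show ?thesis using snoc.prems by (simp add: paths_def proj_star)
  next
    case False
    have es: "es \<in> paths (projections S)" and e: "e \<in> Proj" and ef: "(last es \<cdot> e)\<^sup>* = e"
      using snoc.prems False
      by (auto simp: paths_def proj_rel_def star_projections successively_append_iff)
    have c: "set es \<subseteq> carrier S" "e \<in> carrier S"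
      using es e by (auto simp: paths_def proj_closed)
    have "(drc_prod S es \<cdot> e)\<^sup>* = e"
      using star_congr[of "drc_prod S es" e] snoc.IH[OF es] c ef False by (simp add: drc_prod_closed)
    then show ?thesis using c False by (simp add: drc_prod_append)
  qed
qed (simp add: paths_def)

end

section \<open>The induced homomorphism\<close>

locale projection_hom = S: drc_semigroup S + P: strong_projection_algebra P
  for S :: "('a, 'm) drc_scheme" and P :: "('b, 'n) proj_alg_scheme" +
  fixes \<phi> :: "'b \<Rightarrow> 'a"
  assumes hom: "\<phi> \<in> proj_hom P (projections S)"
begin

lemma hom_closed: "p \<in> carrier P \<Longrightarrow> \<phi> p \<in> S.Proj"
  and hom_times: "p \<in> carrier P \<Longrightarrow> q \<in> carrier P \<Longrightarrow>
        \<phi> (p \<^bold>\<times>\<^bsub>P\<^esub> q) = \<phi> p \<^bold>\<times>\<^bsub>projections S\<^esub> \<phi> q"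
  and hom_star: "p \<in> carrier P \<Longrightarrow> q \<in> carrier P \<Longrightarrow>
        \<phi> (p \<star>\<^bsub>P\<^esub> q) = \<phi> p \<star>\<^bsub>projections S\<^esub> \<phi> q"
  using hom by (auto simp: proj_hom_def)

lemma map_path:
  assumes "ps \<in> paths P"
  shows "map \<phi> ps \<in> paths (projections S)"
proof -
  have "successively (\<lambda>p q. \<F>\<^bsub>projections S\<^esub> (\<phi> p) (\<phi> q)) ps"
  proof (rule successively_mono)
    show "successively (\<lambda>p q. p \<in> carrier P \<and> q \<in> carrier P \<and> \<F>\<^bsub>P\<^esub> p q) ps"
      using assms unfolding paths_def
      by (auto intro: successively_mono[of "\<F>\<^bsub>P\<^esub>"])
  qed (simp add: proj_rel_def flip: hom_times hom_star)
  then show ?thesis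
    using assms hom_closed by (auto simp: paths_def successively_map)
qed

lemma map_push_left:
  "set ps \<subseteq> carrier P \<Longrightarrow> q \<in> carrier P \<Longrightarrow>
     map \<phi> (push_left P ps q) = push_left (projections S) (map \<phi> ps) (\<phi> q)"
proof (induction ps)
  case (Cons p ps)
  let ?L = "push_left P ps q"
  have "hd (?L @ [q]) \<in> carrier P" using Cons.prems by (simp add: P.hd_push_left_closed)
  moreover have "\<phi> (hd (?L @ [q])) = hd (map \<phi> ?L @ [\<phi> q])" by (cases ?L) auto
  ultimately show ?case using Cons by (simp add: hom_times)
qed simp

lemma map_push_right:
  "set qs \<subseteq> carrier P \<Longrightarrow> p \<in> carrier P \<Longrightarrow>
     map \<phi> (push_right P p qs) = push_right (projections S) (\<phi> p) (map \<phi> qs)"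
  by (induction qs arbitrary: p) (auto simp: hom_star P.star_closed)

lemma map_path_prod:
  assumes "ps \<in> paths P" "qs \<in> paths P"
  shows "map \<phi> (path_prod P ps qs) = path_prod (projections S) (map \<phi> ps) (map \<phi> qs)"
  using assms P.hd_path[of qs] P.last_path[of ps]
  by (simp add: path_prod_def map_push_left map_push_right paths_def hd_map last_map)

abbreviation value_of :: "'b list \<Rightarrow> 'a" where
  "value_of ps \<equiv> drc_prod S (map \<phi> ps)"

lemma map_path_carrier:
  assumes "ps \<in> paths P"
  shows "map \<phi> ps \<noteq> []" "set (map \<phi> ps) \<subseteq> S.Proj" "set (map \<phi> ps) \<subseteq> carrier S"
  using map_path[OF assms] S.Proj_list_closed[of "map \<phi> ps"] by (auto simp: paths_def)

text \<open>
  Composition drops one of the two equal entries at the junction, which is harmless because it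
  is mapped to an idempotent.
\<close>

lemma value_of_path_comp:
  assumes "ps \<in> paths P" "qs \<in> paths P" "last ps = hd qs"
  shows "value_of (path_comp ps qs) = value_of ps \<cdot>\<^bsub>S\<^esub> value_of qs"
proof -
  note c = map_path_carrier[OF assms(1)] map_path_carrier[OF assms(2)]
  have l: "value_of ps \<cdot>\<^bsub>S\<^esub> \<phi> (hd qs) = value_of ps"
    using S.drc_prod_last[of "map \<phi> ps"] c hom_closed[OF P.hd_path[OF assms(2)]] assms
    by (simp add: last_map)
  obtain q qs' where qs: "qs = q # qs'" using c by (cases qs) auto
  show ?thesis
  proof (cases "qs' = []")
    case True
    then show ?thesis using l qs by (simp add: path_comp_def)
  next
    case False
    then have "value_of (path_comp ps qs) = value_of ps \<cdot>\<^bsub>S\<^esub> value_of qs'"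
      using c qs by (simp add: path_comp_def S.drc_prod_append)
    also have "\<dots> = (value_of ps \<cdot>\<^bsub>S\<^esub> \<phi> q) \<cdot>\<^bsub>S\<^esub> value_of qs'" using l qs by simp
    also have "\<dots> = value_of ps \<cdot>\<^bsub>S\<^esub> value_of qs"
      using c qs False by (simp add: S.drc_prod_Cons S.drc_prod_closed S.mult_assoc)
    finally show ?thesis .
  qed
qed

text \<open>
  Both sides of a swap generator have the value \<open>(e \<phi>) (p \<phi>) (f \<phi>)\<close>.
\<close>

lemma value_of_chain_rel:
  assumes "(ps, qs) \<in> chain_rel P"
  shows "value_of ps = value_of qs"
  using assms
proof (induction rule: P.chain_rel_induct)
  case (left ps qs us)
  then show ?case
    using P.chain_rel_same_ends[OF left(1)] by (simp add: value_of_path_comp)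
next
  case (right ps qs us)
  then show ?case
    using P.chain_rel_same_ends[OF right(1)] by (simp add: value_of_path_comp)
next
  case (idem p)
  then show ?case
    using hom_closed[of p] by (simp add: S.drc_prod_Cons S.proj_closed S.proj_idem)
next
  case (swap e p f)
  then have c: "e \<in> carrier P" "p \<in> carrier P" "f \<in> carrier P"
    by (auto simp: admissible_def)
  note Q = hom_closed[OF c(1)] hom_closed[OF c(2)] hom_closed[OF c(3)]
  note C = Q[THEN S.proj_closed]
  have "value_of [e, e \<star>\<^bsub>P\<^esub> p, f] = (\<phi> e \<cdot>\<^bsub>S\<^esub> (\<phi> e \<cdot>\<^bsub>S\<^esub> \<phi> p)\<^sup>*\<^bsub>S\<^esub>) \<cdot>\<^bsub>S\<^esub> \<phi> f"
    using c by (simp add: drc_prod_def hom_star star_projections)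
  also have "\<dots> = (\<phi> e \<cdot>\<^bsub>S\<^esub> \<phi> p) \<cdot>\<^bsub>S\<^esub> \<phi> f"
    using Q C by (simp add: S.left_factor_mult_star)
  also have "\<dots> = \<phi> e \<cdot>\<^bsub>S\<^esub> ((\<phi> p \<cdot>\<^bsub>S\<^esub> \<phi> f)\<^sup>+\<^bsub>S\<^esub> \<cdot>\<^bsub>S\<^esub> \<phi> f)"
    using Q C by (simp add: S.plus_mult_right_factor S.mult_assoc)
  also have "\<dots> = value_of [e, p \<^bold>\<times>\<^bsub>P\<^esub> f, f]"
    using c C by (simp add: drc_prod_def hom_times times_projections S.mult_assoc
        S.mult_closed S.plus_closed)
  finally show ?case .
qed simp_all

definition induced :: "'b list set \<Rightarrow> 'a" where
  "induced = restrict (\<lambda>X. value_of (SOME ps. ps \<in> X)) (carrier (chain_semigroup P))"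

lemma chain_class_carrier:
  "ps \<in> paths P \<Longrightarrow> chain_class P ps \<in> carrier (chain_semigroup P)"
  using P.carrier_chain_semigroup by auto

lemma induced_chain_class:
  assumes "ps \<in> paths P"
  shows "induced (chain_class P ps) = value_of ps"
proof -
  have "ps \<in> chain_class P ps" using assms by (simp add: P.mem_chain_class_iff P.chain_rel_refl)
  then have "(SOME ps'. ps' \<in> chain_class P ps) \<in> chain_class P ps" by (rule someI)
  then show ?thesis
    using assms value_of_chain_rel[of ps]
    by (simp add: induced_def chain_class_carrier P.mem_chain_class_iff)
qed

lemma induced_hom: "induced \<in> drc_hom (chain_semigroup P) S"
proof -
  have "induced (chain_class P ps) \<in> carrier S" if "ps \<in> paths P" for ps
    using that map_path_carrier[OF that] S.drc_prod_closed[of "map \<phi> ps"]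
    by (simp add: induced_chain_class)
  moreover have "induced (chain_class P ps \<cdot>\<^bsub>chain_semigroup P\<^esub> chain_class P qs)
      = induced (chain_class P ps) \<cdot>\<^bsub>S\<^esub> induced (chain_class P qs)"
    if "ps \<in> paths P" "qs \<in> paths P" for ps qs
    using that map_path_carrier[OF that(1)] map_path_carrier[OF that(2)]
      S.drc_prod_path_prod[of "map \<phi> ps" "map \<phi> qs"]
    by (simp add: P.chain_class_mult induced_chain_class P.path_prod_path map_path_prod)
  moreover have "induced ((chain_class P ps)\<^sup>+\<^bsub>chain_semigroup P\<^esub>)
      = (induced (chain_class P ps))\<^sup>+\<^bsub>S\<^esub>" if "ps \<in> paths P" for ps
    using that S.drc_prod_plus[OF map_path[OF that]]
    by (simp add: P.chain_class_plus induced_chain_class P.singleton_path P.hd_path hd_map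
        P.not_Nil_path)
  moreover have "induced ((chain_class P ps)\<^sup>*\<^bsub>chain_semigroup P\<^esub>)
      = (induced (chain_class P ps))\<^sup>*\<^bsub>S\<^esub>" if "ps \<in> paths P" for ps
    using that S.drc_prod_star[OF map_path[OF that]]
    by (simp add: P.chain_class_star induced_chain_class P.singleton_path P.last_path last_map
        P.not_Nil_path)
  ultimately show ?thesis
    unfolding drc_hom_def by (auto simp: P.carrier_chain_semigroup)
qed

text \<open>
  Induction along the path, splitting off the first entry by \<open>path_prod_Cons\<close>.
\<close>

lemma hom_chain_class:
  assumes \<Phi>: "\<Phi> \<in> drc_hom (chain_semigroup P) S"
    and ext: "\<And>p. p \<in> carrier P \<Longrightarrow> \<Phi> (chain_class P [p]) = \<phi> p"
  shows "ps \<in> paths P \<Longrightarrow> \<Phi> (chain_class P ps) = value_of ps"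
proof (induction ps)
  case (Cons p ps)
  have p: "p \<in> carrier P" using Cons.prems by (simp add: paths_def)
  show ?case
  proof (cases "ps = []")
    case True
    then show ?thesis using ext p by simp
  next
    case False
    then have ps: "ps \<in> paths P" using Cons.prems by (auto simp: paths_def successively_Cons)
    have p1: "[p] \<in> paths P" using p by (simp add: P.singleton_path)
    have "chain_class P (p # ps)
        = chain_class P [p] \<cdot>\<^bsub>chain_semigroup P\<^esub> chain_class P ps"
      using P.chain_class_mult[OF p1 ps] P.path_prod_Cons[OF Cons.prems False] by simp
    then have "\<Phi> (chain_class P (p # ps)) = \<phi> p \<cdot>\<^bsub>S\<^esub> value_of ps"
      using \<Phi> chain_class_carrier[OF p1] chain_class_carrier[OF ps] ext[OF p] Cons.IH[OF ps]
      by (simp add: drc_hom_def)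
    then show ?thesis
      using map_path_carrier[OF ps] S.proj_closed[OF hom_closed[OF p]]
      by (simp add: S.drc_prod_Cons)
  qed
qed (simp add: paths_def)

end

section \<open>Extending a projection homomorphism to the chain semigroup\<close>

theorem theorem7p18:
  fixes S :: "('a, 'm) drc_scheme"
    and P :: "('b, 'n) proj_alg_scheme"
    and \<phi> :: "'b \<Rightarrow> 'a"
  assumes "drc_restriction_semigroup S"
    and "strong_projection_algebra P"
    and "\<phi> \<in> proj_hom P (projections S)"
  shows "(\<exists>!\<Phi>. \<Phi> \<in> extensional (carrier (chain_semigroup P)) \<and>
              \<Phi> \<in> drc_hom (chain_semigroup P) S \<and>
              (\<forall>p\<in>carrier P. \<Phi> (chain_class P [p]) = \<phi> p))
       \<and> (\<forall>\<Phi>. \<Phi> \<in> drc_hom (chain_semigroup P) S \<and>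
              (\<forall>p\<in>carrier P. \<Phi> (chain_class P [p]) = \<phi> p) \<longrightarrow>
              (\<forall>ps\<in>paths P. \<Phi> (chain_class P ps) = drc_prod S (map \<phi> ps)))"
proof -
  interpret projection_hom S P \<phi>
    using assms drc_restriction_semigroup.axioms(1)
    by (simp add: projection_hom_def projection_hom_axioms_def)
  have "\<exists>!\<Phi>. \<Phi> \<in> extensional (carrier (chain_semigroup P)) \<and>
              \<Phi> \<in> drc_hom (chain_semigroup P) S \<and>
              (\<forall>p\<in>carrier P. \<Phi> (chain_class P [p]) = \<phi> p)"
  proof (intro ex1I[of _ induced] conjI ballI)
    show "induced \<in> extensional (carrier (chain_semigroup P))"
      by (simp add: induced_def)
    show "induced (chain_class P [p]) = \<phi> p" if "p \<in> carrier P" for p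
      using that by (simp add: induced_chain_class P.singleton_path)
    show "\<Phi> = induced"
      if \<Phi>: "\<Phi> \<in> extensional (carrier (chain_semigroup P)) \<and>
              \<Phi> \<in> drc_hom (chain_semigroup P) S \<and>
              (\<forall>p\<in>carrier P. \<Phi> (chain_class P [p]) = \<phi> p)" for \<Phi>
    proof (rule extensionalityI[of _ "carrier (chain_semigroup P)"])
      show "induced \<in> extensional (carrier (chain_semigroup P))"
        by (simp add: induced_def)
      fix X assume "X \<in> carrier (chain_semigroup P)"
      then obtain ps where "ps \<in> paths P" "X = chain_class P ps"
        using P.carrier_chain_semigroup by auto
      then show "\<Phi> X = induced X"
        using hom_chain_class[of \<Phi>] \<Phi> by (simp add: induced_chain_class)
    qed (use \<Phi> in simp)
  qed (rule induced_hom)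
  then show ?thesis using hom_chain_class by blast
qed

end
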